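(* Let $\alpha$ be as specified in each item (complex, with $\operatorname{Re}\alpha>0$ throughout, apart from the value $\Vert k^0\Vert_1$). The following hold. (i) $\Vert k^{-\alpha}\Vert_1=2$ for real $0<\alpha<1$; $\Vert k^0\Vert_1=1$; and $$\Vert k^{-\alpha}\Vert_1\le 2\,\frac{|\alpha|}{\operatorname{Re}\alpha}\,\frac{\Gamma(1-\operatorname{Re}\alpha)}{|\Gamma(1-\alpha)|},\qquad 0<\operatorname{Re}\alpha<1.$$ (ii) $\Vert k^{-m}\Vert_1=2^m$ for every positive integer $m$. (iii) $\Vert k^{-\alpha}\Vert_1\le 2^{[\alpha]+1}$ for every real $\alpha>0$; and $$\Vert k^{-\alpha}\Vert_1\le 2^{[\operatorname{Re}\alpha]+1}\,\frac{|\alpha-[\operatorname{Re}\alpha]|}{\operatorname{Re}\alpha-[\operatorname{Re}\alpha]}\,\frac{\Gamma\bigl(1-(\operatorname{Re}\alpha-[\operatorname{Re}\alpha])\bigr)}{\bigl|\Gamma\bigl(1-(\alpha-[\operatorname{Re}\alpha])\bigr)\bigr|},\qquad \operatorname{Re}\alpha>0.$$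
   Context: For $\alpha\in\mathbb{C}$, the Cesàro numbers $k^\alpha=(k^\alpha(n))_{n\ge 0}$ are defined by $k^\alpha(0)=1$ and $k^\alpha(n)=\frac{\alpha(\alpha+1)\cdots(\alpha+n-1)}{n!}$ for $n\ge 1$. For a complex sequence $f=(f(n))_{n\ge 0}$, $\Vert f\Vert_1=\sum_{n=0}^\infty|f(n)|$. $[x]$ denotes the integer part of a real number $x$, and $\Gamma$ is the Euler Gamma function.
   Formalization: In the last bound of (iii), positive integers α are excluded, since the quotient |α-[Re α]|/(Re α-[Re α]) is 0/0 there; for non-real α with integer real part the quotient is read as infinity. *)

theory Defs
  imports "HOL-Analysis.Analysis"
begin

definition cesaro :: "complex \<Rightarrow> nat \<Rightarrow> complex" where
  "cesaro \<alpha> n = pochhammer \<alpha> n / fact n"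

text \<open>The norm takes values in \<open>[0, \<infinity>]\<close>, so that it is \<open>\<infinity>\<close> for a sequence that is not
  absolutely summable, and every finite bound on it includes absolute summability.\<close>

definition l1_norm :: "(nat \<Rightarrow> complex) \<Rightarrow> ennreal" where
  "l1_norm f = (\<Sum>n. ennreal (cmod (f n)))"

end

theory Submission
  imports Defs
begin

text \<open>
  Everything rests on the Pascal-type recurrence
  \<open>k\<^sup>\<alpha>\<^sup>+\<^sup>1(n+1) = k\<^sup>\<alpha>\<^sup>+\<^sup>1(n) + k\<^sup>\<alpha>(n+1)\<close>: the sequence \<open>k\<^sup>\<alpha>\<close> consists of the differences
  of \<open>k\<^sup>\<alpha>\<^sup>+\<^sup>1\<close>.

  For real \<open>0 < a < 1\<close> the numbers \<open>k\<^sup>1\<^sup>-\<^sup>a(n)\<close> decrease from \<open>1\<close> to \<open>0\<close>, since \<open>1/\<Gamma>(1-a)\<close> is the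
  limit of \<open>k\<^sup>1\<^sup>-\<^sup>a(n) (1-a+n) / n\<^sup>1\<^sup>-\<^sup>a\<close>. Their differences are the terms \<open>k\<^sup>-\<^sup>a(n+1)\<close>, all
  negative, so the sum of the absolute values of these telescopes to \<open>1\<close>, and \<open>k\<^sup>-\<^sup>a(0) = 1\<close> makes the norm \<open>2\<close>
  (\<open>l1_norm_cesaro_real\<close>).

  For complex \<open>\<alpha>\<close> with real part \<open>a\<close> in \<open>(0, 1)\<close>, the sequence is compared term by term with
  \<open>k\<^sup>-\<^sup>a\<close>. The ratio of the moduli is \<open>\<bar>\<alpha>\<bar>/a\<close> times the product of the factors
  \<open>\<bar>j - \<alpha>\<bar> / (j - a) \<ge> 1\<close>. It increases with the index, and by Euler's limit formula for \<open>\<Gamma>\<close>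
  it tends to \<open>\<bar>\<alpha>\<bar>/a \<cdot> \<Gamma>(1-a) / \<bar>\<Gamma>(1-\<alpha>)\<bar>\<close>. The limit therefore bounds every ratio
  (\<open>l1_norm_cesaro_strip\<close>).

  By the recurrence and the triangle inequality, lowering the exponent by \<open>1\<close> at most doubles the
  norm; \<open>[Re \<alpha>]\<close> such steps reduce the last bounds to the strip \<open>0 \<le> Re \<alpha> < 1\<close>
  (\<open>l1_norm_cesaro_shift\<close>). On its edge \<open>Re \<alpha> = 0\<close>, the norm is \<open>1\<close> at \<open>0\<close>, and elsewhere the
  complex bound is infinite. For \<open>\<alpha> = m\<close> a positive integer, \<open>k\<^sup>-\<^sup>m(n)\<close> is a signed
  binomial coefficient, and the exact norm \<open>2\<^sup>m\<close> is the sum of a row of Pascal's triangle.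
\<close>

section \<open>Differences of Cesaro sequences\<close>

lemma cesaro_0 [simp]: "cesaro \<alpha> 0 = 1"
  by (simp add: cesaro_def)

lemma pochhammer_div_fact_rec:
  fixes z :: "'a::field_char_0"
  shows "pochhammer (z + 1) (Suc n) / fact (Suc n)
       = pochhammer (z + 1) n / fact n + pochhammer z (Suc n) / fact (Suc n)"
proof -
  define N :: 'a where "N = of_nat (Suc n)"
  have "N \<noteq> 0" unfolding N_def by (rule of_nat_neq_0)
  have rec: "pochhammer (z + 1) (Suc n) = (N + z) * pochhammer (z + 1) n"
    by (simp add: pochhammer_Suc N_def add_ac mult.commute)
  have fact: "(fact (Suc n) :: 'a) = N * fact n"
    unfolding N_def by (rule fact_Suc)
  show ?thesis
    unfolding rec fact pochhammer_rec[of z]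
    using \<open>N \<noteq> 0\<close> by (simp add: distrib_right add_divide_distrib)
qed

lemma cesaro_rec: "cesaro (\<alpha> + 1) (Suc n) = cesaro (\<alpha> + 1) n + cesaro \<alpha> (Suc n)"
  unfolding cesaro_def by (rule pochhammer_div_fact_rec)

lemma l1_norm_Suc: "l1_norm f = ennreal (cmod (f 0)) + (\<Sum>n. ennreal (cmod (f (Suc n))))"
  unfolding l1_norm_def
  by (subst suminf_offset[where i = 1]) (simp_all add: add.commute)

text \<open>Taking differences is convolution with \<open>k\<^sup>-\<^sup>1 = (1, -1, 0, \<dots>)\<close>, a sequence of norm \<open>2\<close>.\<close>
lemma l1_norm_cesaro_pred: "l1_norm (cesaro \<alpha>) \<le> 2 * l1_norm (cesaro (\<alpha> + 1))"
proof -
  let ?f = "\<lambda>n. ennreal (cmod (cesaro (\<alpha> + 1) n))"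
  have "ennreal (cmod (cesaro \<alpha> (Suc n))) \<le> ?f (Suc n) + ?f n" for n
  proof -
    have "cmod (cesaro \<alpha> (Suc n)) \<le> cmod (cesaro (\<alpha> + 1) (Suc n)) + cmod (cesaro (\<alpha> + 1) n)"
      using norm_triangle_ineq4[of "cesaro (\<alpha> + 1) (Suc n)" "cesaro (\<alpha> + 1) n"]
      by (simp add: cesaro_rec)
    then show ?thesis
      by (metis ennreal_leI ennreal_plus norm_ge_zero)
  qed
  then have "(\<Sum>n. ennreal (cmod (cesaro \<alpha> (Suc n)))) \<le> (\<Sum>n. ?f (Suc n) + ?f n)"
    by (intro suminf_le) auto
  also have "\<dots> = (\<Sum>n. ?f (Suc n)) + (\<Sum>n. ?f n)"
    by (rule suminf_add[symmetric]) auto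
  finally have "l1_norm (cesaro \<alpha>) \<le> 1 + ((\<Sum>n. ?f (Suc n)) + (\<Sum>n. ?f n))"
    by (subst l1_norm_Suc) (simp add: add_left_mono)
  also have "\<dots> = l1_norm (cesaro (\<alpha> + 1)) + (\<Sum>n. ?f n)"
    by (subst l1_norm_Suc) (simp add: add_ac)
  also have "\<dots> = 2 * l1_norm (cesaro (\<alpha> + 1))"
    by (simp add: l1_norm_def mult_2)
  finally show ?thesis .
qed

lemma l1_norm_cesaro_shift:
  "l1_norm (cesaro (- (\<beta> + of_nat m))) \<le> 2 ^ m * l1_norm (cesaro (- \<beta>))"
proof (induction m)
  case (Suc m)
  have "l1_norm (cesaro (- (\<beta> + of_nat (Suc m)))) \<le> 2 * l1_norm (cesaro (- (\<beta> + of_nat m)))"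
    using l1_norm_cesaro_pred[of "- (\<beta> + of_nat (Suc m))"] by (simp add: algebra_simps)
  also have "\<dots> \<le> 2 * (2 ^ m * l1_norm (cesaro (- \<beta>)))"
    by (intro mult_left_mono Suc.IH) simp
  finally show ?case
    by (simp add: mult.assoc)
qed simp

section \<open>Integer exponents\<close>

lemma cesaro_uminus_of_nat: "cesaro (- of_nat m) n = (- 1) ^ n * of_nat (m choose n)"
  unfolding cesaro_def binomial_gbinomial gbinomial_pochhammer
  by (cases "even n") simp_all

lemma l1_norm_cesaro_of_nat: "l1_norm (cesaro (- of_nat m)) = 2 ^ m"
proof -
  have "l1_norm (cesaro (- of_nat m)) = (\<Sum>n. ennreal (of_nat (m choose n)))"
    unfolding l1_norm_def cesaro_uminus_of_nat by (simp add: norm_mult norm_power)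
  also have "\<dots> = (\<Sum>n\<le>m. ennreal (of_nat (m choose n)))"
    by (rule suminf_finite) auto
  also have "\<dots> = ennreal (of_nat (\<Sum>n\<le>m. m choose n))"
    by simp
  also have "\<dots> = 2 ^ m"
    by (simp add: choose_row_sum flip: ennreal_numeral ennreal_power)
  finally show ?thesis .
qed

section \<open>Real exponents between 0 and 1\<close>

text \<open>The Euler approximants \<open>z(z+1)\<dots>(z+n) / (n! n\<^sup>z)\<close> to \<open>1/\<Gamma>(z)\<close> converge, hence are
  bounded, and the quantity here is \<open>n\<^sup>z / (z+n) \<le> n\<^bsup>z-1\<^esup>\<close> times such an approximant.\<close>
lemma pochhammer_div_fact_tendsto_0:
  fixes z :: real
  assumes "0 < z" "z < 1"
  shows "(\<lambda>n. pochhammer z n / fact n) \<longlonglongrightarrow> 0"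
proof -
  have "(\<lambda>n. rGamma_series z n * (exp (z * ln (real n)) / (z + real n))) \<longlonglongrightarrow> rGamma z * 0"
  proof (intro tendsto_mult rGamma_series_LIMSEQ)
    let ?q = "\<lambda>n. exp (z * ln (real n)) / (z + real n)"
    have lim: "(\<lambda>n. real n powr (z - 1)) \<longlonglongrightarrow> 0"
      using assms by (intro tendsto_neg_powr filterlim_real_sequentially) auto
    have upper: "\<forall>\<^sub>F n in sequentially. ?q n \<le> real n powr (z - 1)"
      using eventually_gt_at_top[of 0]
    proof eventually_elim
      case (elim n)
      then have "real n powr (z - 1) = exp (z * ln (real n)) / real n"
        using powr_diff[of "real n" z 1] by (simp add: powr_def)
      then show ?case
        using elim assms by (simp add: divide_left_mono)
    qed
    have lower: "\<forall>\<^sub>F n in sequentially. 0 \<le> ?q n"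
      using assms by (intro always_eventually) auto
    show "?q \<longlonglongrightarrow> 0"
      by (rule tendsto_sandwich[OF lower upper tendsto_const lim])
  qed
  moreover have "rGamma_series z n * (exp (z * ln (real n)) / (z + real n))
      = pochhammer z n / fact n" for n
  proof -
    have "z + real n \<noteq> 0" using assms by linarith
    then show ?thesis
      by (simp add: rGamma_series_def pochhammer_Suc)
  qed
  ultimately show ?thesis by simp
qed

lemma cesaro_of_real: "cesaro (complex_of_real x) n = complex_of_real (pochhammer x n / fact n)"
  by (simp add: cesaro_def pochhammer_of_real)

lemma cmod_cesaro_real_Suc:
  assumes "0 < a" "a < 1"
  shows "cmod (cesaro (- complex_of_real a) (Suc n)) = a * pochhammer (1 - a) n / fact (Suc n)"
proof -
  have "pochhammer (- a) (Suc n) = - (a * pochhammer (1 - a) n)"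
    using pochhammer_rec[of "- a" n] by (simp del: pochhammer_Suc)
  then have "cesaro (- complex_of_real a) (Suc n)
      = complex_of_real (- (a * pochhammer (1 - a) n / fact (Suc n)))"
    using cesaro_of_real[of "- a" "Suc n"] by (simp del: fact_Suc)
  moreover have "0 \<le> a * pochhammer (1 - a) n / fact (Suc n)"
    using assms by (intro divide_nonneg_pos mult_nonneg_nonneg pochhammer_nonneg) auto
  ultimately show ?thesis
    by (metis norm_of_real abs_minus_cancel abs_of_nonneg)
qed

text \<open>Since \<open>k\<^sup>1\<^sup>-\<^sup>a\<close> decreases, the moduli are its successive decrements: their sum is its total
  decrease, from \<open>1\<close> to \<open>0\<close>.\<close>
lemma cesaro_real_tail_sums:
  assumes "0 < a" "a < 1"
  shows "(\<lambda>n. cmod (cesaro (- complex_of_real a) (Suc n))) sums 1"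
proof -
  let ?u = "\<lambda>n. pochhammer (1 - a) n / fact n"
  have "cmod (cesaro (- complex_of_real a) (Suc n)) = ?u n - ?u (Suc n)" for n
    using pochhammer_div_fact_rec[of "- a" n] pochhammer_rec[of "- a" n]
    by (simp add: cmod_cesaro_real_Suc[OF assms] add.commute)
  moreover have "(\<lambda>n. ?u n - ?u (Suc n)) sums (?u 0 - 0)"
    using assms by (intro telescope_sums' pochhammer_div_fact_tendsto_0) auto
  ultimately show ?thesis by simp
qed

lemma l1_norm_cesaro_real:
  assumes "0 < a" "a < 1"
  shows "l1_norm (cesaro (- complex_of_real a)) = 2"
proof -
  have "(\<Sum>n. ennreal (cmod (cesaro (- complex_of_real a) (Suc n)))) = ennreal 1"
    by (intro suminf_ennreal_eq cesaro_real_tail_sums assms) simp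
  then show ?thesis
    by (subst l1_norm_Suc) (simp only: cesaro_0 norm_one ennreal_1 one_add_one)
qed

section \<open>Comparison of a complex exponent with its real part\<close>

text \<open>Each factor of the product has modulus at least its real part, so the ratio increases with
  \<open>n\<close>. In the quotient of the Euler approximants to \<open>1/\<Gamma>(z)\<close> and \<open>1/\<Gamma>(Re z)\<close> the
  powers \<open>n\<^sup>z\<close> and \<open>n\<^bsup>Re z\<^esup>\<close> have the same modulus, and what remains is exactly this ratio.\<close>
lemma pochhammer_ratio_le_Gamma_ratio:
  assumes "0 < Re z"
  shows "cmod (pochhammer z n) / pochhammer (Re z) n \<le> Gamma (Re z) / cmod (Gamma z)"
proof -
  define r where "r n = cmod (pochhammer z n) / pochhammer (Re z) n" for n
  have "incseq r"
  proof (rule incseq_SucI)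
    fix n
    have "Re z + real n \<le> cmod (z + of_nat n)"
      using complex_Re_le_cmod[of "z + of_nat n"] by simp
    then have "1 \<le> cmod (z + of_nat n) / (Re z + real n)"
      using assms by simp
    moreover have "0 \<le> r n"
      unfolding r_def using assms by (intro divide_nonneg_pos pochhammer_pos) auto
    ultimately have "r n * 1 \<le> r n * (cmod (z + of_nat n) / (Re z + real n))"
      by (intro mult_left_mono)
    also have "\<dots> = r (Suc n)"
      by (simp add: r_def pochhammer_Suc norm_mult)
    finally show "r n \<le> r (Suc n)" by simp
  qed
  moreover have "r \<longlonglongrightarrow> Gamma (Re z) / cmod (Gamma z)"
  proof -
    have "rGamma (Re z) \<noteq> 0"
      using assms by (auto simp: rGamma_eq_zero_iff elim!: nonpos_Ints_cases)
    then have "(\<lambda>n. cmod (rGamma_series z n) / rGamma_series (Re z) n)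
        \<longlonglongrightarrow> cmod (rGamma z) / rGamma (Re z)"
      by (intro tendsto_divide tendsto_norm rGamma_series_LIMSEQ)
    moreover have "cmod (rGamma_series z n) / rGamma_series (Re z) n = r (Suc n)" for n
      by (simp add: rGamma_series_def r_def norm_mult norm_divide)
    moreover have "cmod (rGamma z) / rGamma (Re z) = Gamma (Re z) / cmod (Gamma z)"
      by (simp add: rGamma_inverse_Gamma norm_inverse divide_inverse mult.commute)
    ultimately have "(\<lambda>n. r (Suc n)) \<longlonglongrightarrow> Gamma (Re z) / cmod (Gamma z)"
      by simp
    then show ?thesis by (rule LIMSEQ_imp_Suc)
  qed
  ultimately show ?thesis
    unfolding r_def by (rule incseq_le)
qed

text \<open>The constant \<open>C\<close> dominates the ratio to \<open>k\<^sup>-\<^sup>a\<close> (with \<open>a = Re \<alpha>\<close>) at every index from \<open>1\<close>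
  on. The terms there add up to \<open>1\<close> for \<open>k\<^sup>-\<^sup>a\<close>, and the leading term is \<open>1 \<le> C\<close>, so each of the
  two parts contributes at most \<open>C\<close>.\<close>
lemma l1_norm_cesaro_strip:
  assumes "0 < Re \<alpha>" "Re \<alpha> < 1"
  shows "l1_norm (cesaro (- \<alpha>))
    \<le> ennreal (2 * (cmod \<alpha> / Re \<alpha>) * (Gamma (1 - Re \<alpha>) / cmod (Gamma (1 - \<alpha>))))"
proof -
  define L where "L = Gamma (1 - Re \<alpha>) / cmod (Gamma (1 - \<alpha>))"
  define C where "C = cmod \<alpha> / Re \<alpha> * L"
  let ?c = "\<lambda>n. cmod (cesaro (- complex_of_real (Re \<alpha>)) (Suc n))"
  have L: "cmod (pochhammer (1 - \<alpha>) n) / pochhammer (1 - Re \<alpha>) n \<le> L" for n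
    using pochhammer_ratio_le_Gamma_ratio[of "1 - \<alpha>" n] assms by (simp add: L_def)
  have "1 \<le> L" using L[of 0] by simp
  moreover have "1 \<le> cmod \<alpha> / Re \<alpha>"
    using assms complex_Re_le_cmod[of \<alpha>] by simp
  ultimately have "1 * 1 \<le> cmod \<alpha> / Re \<alpha> * L" by (intro mult_mono) auto
  then have C: "1 \<le> C" by (simp add: C_def)
  have le: "cmod (cesaro (- \<alpha>) (Suc n)) \<le> C * ?c n" for n
  proof -
    have p: "0 < pochhammer (1 - Re \<alpha>) n" using assms by (intro pochhammer_pos) auto
    have "cmod (cesaro (- \<alpha>) (Suc n))
        = cmod \<alpha> / fact (Suc n) * cmod (pochhammer (1 - \<alpha>) n)"
      by (simp add: cesaro_def pochhammer_rec norm_mult norm_divide del: fact_Suc)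
    also have "\<dots> \<le> cmod \<alpha> / fact (Suc n) * (L * pochhammer (1 - Re \<alpha>) n)"
      using L[of n] p by (intro mult_left_mono) (simp_all add: field_simps)
    also have "\<dots> = C * ?c n"
      using assms by (simp add: cmod_cesaro_real_Suc C_def del: fact_Suc)
    finally show ?thesis .
  qed
  have "(\<Sum>n. ennreal (cmod (cesaro (- \<alpha>) (Suc n)))) \<le> (\<Sum>n. ennreal (C * ?c n))"
    by (intro suminf_le ennreal_leI le) auto
  also have "\<dots> = ennreal (C * 1)"
    using C by (intro suminf_ennreal_eq sums_mult cesaro_real_tail_sums assms) auto
  finally have "l1_norm (cesaro (- \<alpha>)) \<le> 1 + ennreal C"
    by (subst l1_norm_Suc) (simp add: add_left_mono)
  also have "\<dots> \<le> ennreal C + ennreal C"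
    using C by (intro add_right_mono) (metis ennreal_1 ennreal_leI)
  also have "\<dots> = ennreal (2 * C)"
    using C by (simp flip: ennreal_plus)
  finally show ?thesis
    by (simp add: C_def L_def mult.assoc)
qed

section \<open>Arbitrary exponents\<close>

lemma l1_norm_cesaro_real_le:
  assumes "0 < a"
  shows "l1_norm (cesaro (- complex_of_real a)) \<le> 2 ^ (nat \<lfloor>a\<rfloor> + 1)"
proof -
  define m where "m = nat \<lfloor>a\<rfloor>"
  define b where "b = a - real m"
  have m: "real m = of_int \<lfloor>a\<rfloor>" using assms by (simp add: m_def)
  have b: "0 \<le> b" "b < 1" unfolding b_def m by linarith+
  have "l1_norm (cesaro (- complex_of_real b)) \<le> 2"
    using l1_norm_cesaro_real[of b] l1_norm_cesaro_of_nat[of 0] b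
    by (cases "b = 0") auto
  then have "2 ^ m * l1_norm (cesaro (- complex_of_real b)) \<le> 2 ^ m * 2"
    by (intro mult_left_mono) auto
  with l1_norm_cesaro_shift[of "complex_of_real b" m]
  have "l1_norm (cesaro (- (complex_of_real b + of_nat m))) \<le> 2 ^ m * 2"
    by (rule order_trans)
  moreover have "complex_of_real b + of_nat m = complex_of_real a"
    by (simp add: b_def)
  ultimately show ?thesis
    unfolding m_def by (metis power_add power_one_right)
qed

lemma l1_norm_cesaro_complex_le:
  assumes "0 < Re \<alpha>" "\<alpha> \<notin> \<int>"
  shows "l1_norm (cesaro (- \<alpha>))
    \<le> 2 ^ (nat \<lfloor>Re \<alpha>\<rfloor> + 1)
       * (ennreal (cmod (\<alpha> - of_int \<lfloor>Re \<alpha>\<rfloor>)) / ennreal (Re \<alpha> - of_int \<lfloor>Re \<alpha>\<rfloor>))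
       * ennreal (Gamma (1 - (Re \<alpha> - of_int \<lfloor>Re \<alpha>\<rfloor>))
                    / cmod (Gamma (1 - (\<alpha> - of_int \<lfloor>Re \<alpha>\<rfloor>))))"
proof -
  define m where "m = nat \<lfloor>Re \<alpha>\<rfloor>"
  define \<beta> where "\<beta> = \<alpha> - of_int \<lfloor>Re \<alpha>\<rfloor>"
  have int_m: "int m = \<lfloor>Re \<alpha>\<rfloor>" using assms by (simp add: m_def)
  have Re: "Re \<beta> = Re \<alpha> - of_int \<lfloor>Re \<alpha>\<rfloor>" by (simp add: \<beta>_def)
  have b: "0 \<le> Re \<beta>" "Re \<beta> < 1" unfolding Re by linarith+
  have "\<beta> \<noteq> 0" using assms(2) unfolding \<beta>_def by (metis Ints_of_int right_minus_eq)
  define L where "L = Gamma (1 - Re \<beta>) / cmod (Gamma (1 - \<beta>))"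
  have "1 \<le> L"
    using pochhammer_ratio_le_Gamma_ratio[of "1 - \<beta>" 0] b by (simp add: L_def)
  have "l1_norm (cesaro (- \<alpha>)) \<le> 2 ^ (m + 1) * (ennreal (cmod \<beta>) / ennreal (Re \<beta>)) * ennreal L"
  proof (cases "Re \<beta> = 0")
    case True
    \<comment> \<open>A non-real \<open>\<alpha>\<close> with integer real part: the quotient by \<open>0\<close> is infinite in \<open>[0, \<infinity>]\<close>, and
      the other factors are positive, so the bound is infinite.\<close>
    with \<open>\<beta> \<noteq> 0\<close> \<open>1 \<le> L\<close> show ?thesis
      by (simp add: ennreal_divide_zero ennreal_mult_top ennreal_top_mult)
  next
    case False
    with b have "0 < Re \<beta>" by simp
    have "l1_norm (cesaro (- (\<beta> + of_nat m))) \<le> 2 ^ m * l1_norm (cesaro (- \<beta>))"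
      by (rule l1_norm_cesaro_shift)
    also have "\<dots> \<le> 2 ^ m * ennreal (2 * (cmod \<beta> / Re \<beta>) * L)"
      unfolding L_def using \<open>0 < Re \<beta>\<close> b
      by (intro mult_left_mono l1_norm_cesaro_strip) auto
    also have "\<dots> = 2 ^ (m + 1) * (ennreal (cmod \<beta>) / ennreal (Re \<beta>)) * ennreal L"
    proof -
      have "ennreal (2 * (cmod \<beta> / Re \<beta>) * L)
          = ennreal 2 * ennreal (cmod \<beta> / Re \<beta>) * ennreal L"
        using \<open>0 < Re \<beta>\<close> \<open>1 \<le> L\<close>
        by (subst ennreal_mult, simp, simp, subst ennreal_mult) simp_all
      then show ?thesis
        using \<open>0 < Re \<beta>\<close> by (simp add: divide_ennreal mult_ac)
    qed
    also have "\<beta> + of_nat m = \<alpha>"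
      unfolding \<beta>_def int_m[symmetric] by simp
    finally show ?thesis .
  qed
  then show ?thesis
    by (simp add: L_def m_def Re \<beta>_def)
qed

theorem theorem2p2:
  shows
    "(\<forall>\<alpha>::real. 0 < \<alpha> \<and> \<alpha> < 1 \<longrightarrow> l1_norm (cesaro (- complex_of_real \<alpha>)) = 2)
     \<and> l1_norm (cesaro 0) = 1
     \<and> (\<forall>\<alpha>::complex. 0 < Re \<alpha> \<and> Re \<alpha> < 1 \<longrightarrow>
          l1_norm (cesaro (- \<alpha>))
            \<le> ennreal (2 * (cmod \<alpha> / Re \<alpha>) * (Gamma (1 - Re \<alpha>) / cmod (Gamma (1 - \<alpha>)))))
     \<and> (\<forall>m::nat. 0 < m \<longrightarrow> l1_norm (cesaro (- of_nat m)) = 2 ^ m)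
     \<and> (\<forall>\<alpha>::real. 0 < \<alpha> \<longrightarrow>
          l1_norm (cesaro (- complex_of_real \<alpha>)) \<le> 2 ^ (nat \<lfloor>\<alpha>\<rfloor> + 1))
     \<and> (\<forall>\<alpha>::complex. 0 < Re \<alpha> \<and> \<alpha> \<notin> \<int> \<longrightarrow>
          l1_norm (cesaro (- \<alpha>))
            \<le> 2 ^ (nat \<lfloor>Re \<alpha>\<rfloor> + 1)
               * (ennreal (cmod (\<alpha> - of_int \<lfloor>Re \<alpha>\<rfloor>)) / ennreal (Re \<alpha> - of_int \<lfloor>Re \<alpha>\<rfloor>))
               * ennreal (Gamma (1 - (Re \<alpha> - of_int \<lfloor>Re \<alpha>\<rfloor>))
                            / cmod (Gamma (1 - (\<alpha> - of_int \<lfloor>Re \<alpha>\<rfloor>)))))"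
  using l1_norm_cesaro_real l1_norm_cesaro_of_nat[of 0] l1_norm_cesaro_strip
    l1_norm_cesaro_of_nat l1_norm_cesaro_real_le l1_norm_cesaro_complex_le
  by (intro conjI allI impI) (simp_all del: power_Suc)

end
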